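(* The lattice of subTuring degrees is not distributive; that is, there exist partial functions $f,g,h\colon\subseteq\omega\to\omega$ such that $f\oplus(g\cap h)\not\equiv_{\rm subT}(f\oplus g)\cap(f\oplus h)$.
   Context: For a partial computable function $\Phi$ from finite sequences of natural numbers to $\{0,1\}\times\omega$ and a partial function $g\colon\subseteq\omega\to\omega$, the $g$-relative sequential computation $\Phi[g]$ is defined as follows. On input $n$, with oracle answers $a_0,\dots,a_{s-1}$ obtained so far: if $\Phi(n,a_0,\dots,a_{s-1})$ is undefined, $\Phi[g](n)$ is undefined; if it equals $\langle 1,q\rangle$ the computation halts with output $q$; if it equals $\langle 0,q\rangle$, $q$ is a query, and if $q\in{\rm dom}(g)$ the computation continues with $a_s=g(q)$, while if $q\notin{\rm dom}(g)$ the computation never halts. $\Phi_e$ is the $e$-th such partial computable function. $f\leq_{\rm subT} g$ means $f\subseteq\Phi_e[g]$ for some $e$; $\equiv_{\rm subT}$ is mutual reducibility. The join is $(f\oplus g)(2n)=f(n)$, $(f\oplus g)(2n+1)=g(n)$, and the meet $f\cap g$ is $(f\cap g)(\langle d,e,n\rangle)=\Phi_d[f](n)$ if $\Phi_d[f](n)$ and $\Phi_e[g](n)$ are both defined and equal, undefined otherwise; these give the least upper bound and greatest lower bound in the subTuring degrees. *)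

theory Defs
  imports Main "HOL-Library.Nat_Bijection"
begin

text \<open>
  Partial computable functions of one argument, in the presentation with primitive Cantor
  pairing \<^const>\<open>prod_encode\<close> (several arguments are coded as one): the least class that contains
  zero, successor and the two projections and is closed under pairing, composition, primitive
  recursion and unbounded minimization. \<^const>\<open>None\<close> means undefined.
\<close>

datatype code =
    Zero
  | Succ
  | ProjL
  | ProjR
  | Pairing code code
  | Comp code code
  | Prec code code
  | Mu code

primrec eval :: "code \<Rightarrow> nat \<rightharpoonup> nat" where
  "eval Zero x = Some 0"
| "eval Succ x = Some (Suc x)"
| "eval ProjL x = Some (fst (prod_decode x))"
| "eval ProjR x = Some (snd (prod_decode x))"
| "eval (Pairing p q) x =
     Option.bind (eval p x) (\<lambda>a. Option.bind (eval q x) (\<lambda>b. Some (prod_encode (a, b))))"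
| "eval (Comp p q) x = Option.bind (eval q x) (eval p)"
| "eval (Prec p q) x =
     (case prod_decode x of (a, n) \<Rightarrow>
        rec_nat (eval p a)
          (\<lambda>y r. Option.bind r (\<lambda>i. eval q (prod_encode (a, prod_encode (y, i))))) n)"
| "eval (Mu p) x =
     (if \<exists>n. eval p (prod_encode (x, n)) = Some 0 \<and>
             (\<forall>m<n. \<exists>v. eval p (prod_encode (x, m)) = Some (Suc v))
      then Some (LEAST n. eval p (prod_encode (x, n)) = Some 0)
      else None)"

text \<open>An effective bijective Goedel numbering of the codes.\<close>

function code_of :: "nat \<Rightarrow> code" where
  "code_of n =
     (if n = 0 then Zero
      else if n = 1 then Succ
      else if n = 2 then ProjL
      else if n = 3 then ProjR
      else let m = (n - 4) div 4; r = (n - 4) mod 4;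
               a = fst (prod_decode m); b = snd (prod_decode m)
           in if r = 0 then Pairing (code_of a) (code_of b)
              else if r = 1 then Comp (code_of a) (code_of b)
              else if r = 2 then Prec (code_of a) (code_of b)
              else Mu (code_of m))"
  by pat_completeness auto
termination
proof (relation "measure id", goal_cases)
  have L: "fst (prod_decode m) \<le> m" and R: "snd (prod_decode m) \<le> m" for m
    using le_prod_encode_1[of "fst (prod_decode m)" "snd (prod_decode m)"]
      le_prod_encode_2[of "snd (prod_decode m)" "fst (prod_decode m)"] by simp_all
  have D: "(n - 4) div 4 < n" if "n \<noteq> 0" for n :: nat
    using that by presburger
  {
    case 1 show ?case by simp
  next
    case 2 then show ?case using le_less_trans[OF L D] by simp
  next
    case 3 then show ?case using le_less_trans[OF R D] by simp
  next
    case 4 then show ?case using le_less_trans[OF L D] by simp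
  next
    case 5 then show ?case using le_less_trans[OF R D] by simp
  next
    case 6 then show ?case using le_less_trans[OF L D] by simp
  next
    case 7 then show ?case using le_less_trans[OF R D] by simp
  next
    case 8 then show ?case using D by simp
  }
qed

declare code_of.simps [simp del]

primrec index_of :: "code \<Rightarrow> nat" where
  "index_of Zero = 0"
| "index_of Succ = 1"
| "index_of ProjL = 2"
| "index_of ProjR = 3"
| "index_of (Pairing p q) = 4 * prod_encode (index_of p, index_of q) + 4"
| "index_of (Comp p q) = 4 * prod_encode (index_of p, index_of q) + 5"
| "index_of (Prec p q) = 4 * prod_encode (index_of p, index_of q) + 6"
| "index_of (Mu p) = 4 * index_of p + 7"

lemma code_of_index_of [simp]: "code_of (index_of p) = p"
proof (induction p)
  case (Pairing p q)
  then show ?case by (subst code_of.simps) simp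
next
  case (Comp p q)
  have "(4 * k + 1) div 4 = k" "(4 * k + 1) mod 4 = 1" for k :: nat
    by presburger+
  with Comp show ?case by (subst code_of.simps) (simp add: Let_def)
next
  case (Prec p q)
  have "(4 * k + 2) div 4 = k" "(4 * k + 2) mod 4 = 2" for k :: nat
    by presburger+
  with Prec show ?case by (subst code_of.simps) (simp add: Let_def)
next
  case (Mu p)
  have "(4 * k + 3) div 4 = k" "(4 * k + 3) mod 4 = 3" for k :: nat
    by presburger+
  with Mu show ?case by (subst code_of.simps) (simp add: Let_def)
qed (subst code_of.simps, simp)+

text \<open>
  \<open>Phi e\<close> is the \<open>e\<close>-th partial computable function from finite sequences to \<open>{0,1} \<times> \<omega>\<close>;
  \<^const>\<open>False\<close> stands for 0 (query) and \<^const>\<open>True\<close> for 1 (halt). A computation whose result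
  does not code an element of \<open>{0,1} \<times> \<omega>\<close> counts as undefined.
\<close>

definition Phi :: "nat \<Rightarrow> nat list \<rightharpoonup> bool \<times> nat" where
  "Phi e s = Option.bind (eval (code_of e) (list_encode s))
     (\<lambda>v. case prod_decode v of (i, q) \<Rightarrow>
        if i = 0 then Some (False, q) else if i = 1 then Some (True, q) else None)"

text \<open>
  \<open>run F g s\<close> continues the sequential computation from the history \<open>s\<close>, which consists of the
  input followed by the oracle answers obtained so far. As a least fixed point in the option
  domain it is \<^const>\<open>None\<close> also if infinitely many queries are made.
\<close>

partial_function (option) run ::
    "(nat list \<rightharpoonup> bool \<times> nat) \<Rightarrow> (nat \<rightharpoonup> nat) \<Rightarrow> nat list \<rightharpoonup> nat" where
  "run F g s = Option.bind (F s)
     (\<lambda>(halt, q). if halt then Some q else Option.bind (g q) (\<lambda>a. run F g (s @ [a])))"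

definition seq_comp :: "(nat list \<rightharpoonup> bool \<times> nat) \<Rightarrow> (nat \<rightharpoonup> nat) \<Rightarrow> nat \<rightharpoonup> nat" where
  "seq_comp F g n = run F g [n]"

definition subT_le :: "(nat \<rightharpoonup> nat) \<Rightarrow> (nat \<rightharpoonup> nat) \<Rightarrow> bool" (infix "\<le>\<^sub>s\<^sub>u\<^sub>b\<^sub>T" 50) where
  "f \<le>\<^sub>s\<^sub>u\<^sub>b\<^sub>T g \<longleftrightarrow> (\<exists>e. f \<subseteq>\<^sub>m seq_comp (Phi e) g)"

definition subT_equiv :: "(nat \<rightharpoonup> nat) \<Rightarrow> (nat \<rightharpoonup> nat) \<Rightarrow> bool" (infix "\<equiv>\<^sub>s\<^sub>u\<^sub>b\<^sub>T" 50) where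
  "f \<equiv>\<^sub>s\<^sub>u\<^sub>b\<^sub>T g \<longleftrightarrow> f \<le>\<^sub>s\<^sub>u\<^sub>b\<^sub>T g \<and> g \<le>\<^sub>s\<^sub>u\<^sub>b\<^sub>T f"

definition subT_join :: "(nat \<rightharpoonup> nat) \<Rightarrow> (nat \<rightharpoonup> nat) \<Rightarrow> nat \<rightharpoonup> nat" (infixl "\<oplus>\<^sub>s\<^sub>u\<^sub>b\<^sub>T" 65) where
  "(f \<oplus>\<^sub>s\<^sub>u\<^sub>b\<^sub>T g) m = (if even m then f (m div 2) else g (m div 2))"

text \<open>\<open>\<langle>d,e,n\<rangle>\<close> is \<open>prod_encode (d, prod_encode (e, n))\<close>.\<close>

definition subT_meet :: "(nat \<rightharpoonup> nat) \<Rightarrow> (nat \<rightharpoonup> nat) \<Rightarrow> nat \<rightharpoonup> nat" (infixl "\<sqinter>\<^sub>s\<^sub>u\<^sub>b\<^sub>T" 70) where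
  "(f \<sqinter>\<^sub>s\<^sub>u\<^sub>b\<^sub>T g) m =
     (case prod_decode m of (d, r) \<Rightarrow> case prod_decode r of (e, n) \<Rightarrow>
        case (seq_comp (Phi d) f n, seq_comp (Phi e) g n) of
          (Some u, Some v) \<Rightarrow> if u = v then Some u else None
        | _ \<Rightarrow> None)"

end

theory Submission imports Defs begin

text \<open>
  Build \<open>f\<close>, \<open>g\<close>, \<open>h\<close> with \<open>f (g n) = f (h n) =: k n\<close> on \<open>dom g = dom h\<close>. Then \<open>k\<close> lies below both
  \<open>f \<oplus> g\<close> and \<open>f \<oplus> h\<close>, but only by querying \<open>f\<close> at an address supplied by \<open>g\<close> or by \<open>h\<close>, and
  \<open>g \<sqinter> h\<close> reveals no such address. The functions are constructed by finite extension, everything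
  below a bound \<open>N\<close> being settled. At a stage put \<open>n = N\<close>; the addresses \<open>a = g n\<close>, \<open>b = h n\<close> and
  the value \<open>c = f a = f b\<close> are still free. If some choice of \<open>a\<close>, \<open>b\<close> leaves a query to
  \<open>g \<sqinter> h\<close> unanswered, then it stays so once the bound is raised; otherwise the answer,
  being computed from \<open>a\<close> alone and also from \<open>b\<close> alone, is independent of both. So
  the reduction to be defeated is run with the answers that do not depend on \<open>a\<close>, \<open>b\<close>:
  if it halts, \<open>c\<close> is chosen different from the output; if it gets stuck, it can be kept stuck.
\<close>

section \<open>Sequential computations and their oracles\<close>

lemma run_halt: "F s = Some (True, v) \<Longrightarrow> run F g s = Some v"
  by (subst run.simps) simp

lemma run_query: "F s = Some (False, q) \<Longrightarrow> g q = Some a \<Longrightarrow> run F g s = run F g (s @ [a])"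
  by (subst run.simps) simp

lemma run_induct [consumes 1, case_names halt query]:
  assumes "run F g s = Some v"
    and "\<And>s. F s = Some (True, v) \<Longrightarrow> P s"
    and "\<And>s q a. F s = Some (False, q) \<Longrightarrow> g q = Some a \<Longrightarrow> P (s @ [a]) \<Longrightarrow> P s"
  shows "P s"
proof -
  \<comment> \<open>The fixed-point induction lets \<open>F\<close>, \<open>g\<close> and
    \<open>v\<close> vary; these equations, stated for the varying copies, tie them back to the
    given ones.\<close>
  have "F = F \<longrightarrow> g = g \<longrightarrow> v = v \<longrightarrow> P s"
  proof (rule run.raw_induct[where P = "\<lambda>F' g' s v'. F' = F \<longrightarrow> g' = g \<longrightarrow> v' = v \<longrightarrow> P s",
        OF _ assms(1)], intro impI)
    fix run' F' g' s v'
    assume IH: "\<And>F' g' s v'. run' F' g' s = Some v' \<Longrightarrow> F' = F \<longrightarrow> g' = g \<longrightarrow> v' = v \<longrightarrow> P s"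
      and step: "Option.bind (F' s) (\<lambda>(halt, q). if halt then Some q
        else Option.bind (g' q) (\<lambda>a. run' F' g' (s @ [a]))) = Some v'"
      and eq: "F' = F" "g' = g" "v' = v"
    from step consider "F s = Some (True, v)"
      | q a where "F s = Some (False, q)" "g q = Some a" "run' F g (s @ [a]) = Some v"
      unfolding eq by (auto simp: bind_eq_Some_conv split: if_splits)
    then show "P s"
      using IH assms(2,3) by cases blast+
  qed
  then show ?thesis by simp
qed

lemma run_mono:
  assumes "run F g s = Some v" "g \<subseteq>\<^sub>m g'"
  shows "run F g' s = Some v"
  using assms(1)
proof (induction rule: run_induct)
  case (halt s)
  then show ?case by (rule run_halt)
next
  case (query s q a)
  then have "g' q = Some a"
    using assms(2) by (force simp: map_le_def dom_def)
  with query show ?case by (simp add: run_query)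
qed

lemma seq_comp_mono: "seq_comp F g n = Some v \<Longrightarrow> g \<subseteq>\<^sub>m g' \<Longrightarrow> seq_comp F g' n = Some v"
  unfolding seq_comp_def by (rule run_mono)

text \<open>The runs under \<open>g\<close> and \<open>g\<^sub>1\<close> share their history up to
  the first query outside \<open>dom g\<close>; this query is \<open>x\<close>. Convergence under
  \<open>g\<^sub>1\<close> rules out the other sources of divergence, an undefined \<open>F\<close>
  and an infinite run.\<close>

lemma run_stuck:
  assumes "run F g\<^sub>1 s = Some v" "g \<subseteq>\<^sub>m g\<^sub>1" "run F g s = None"
  obtains x where "g x = None" "\<And>g'. g \<subseteq>\<^sub>m g' \<Longrightarrow> g' x = None \<Longrightarrow> run F g' s = None"
proof -
  have "\<exists>x. g x = None \<and> (\<forall>g'. g \<subseteq>\<^sub>m g' \<longrightarrow> g' x = None \<longrightarrow> run F g' s = None)"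
    using assms(1,3)
  proof (induction rule: run_induct)
    case (halt s)
    then show ?case by (simp add: run_halt)
  next
    case (query s q a)
    show ?case
    proof (cases "g q")
      case None
      have "run F g' s = None" if "g' q = None" for g'
        using that query.hyps by (subst run.simps) simp
      with None show ?thesis by blast
    next
      case (Some b)
      with assms(2) query.hyps have b: "b = a"
        by (force simp: map_le_def dom_def)
      then obtain x where x: "g x = None"
          "\<And>g'. g \<subseteq>\<^sub>m g' \<Longrightarrow> g' x = None \<Longrightarrow> run F g' (s @ [a]) = None"
        using query Some run_query[of F s q g a] by auto
      have "run F g' s = None" if "g \<subseteq>\<^sub>m g'" "g' x = None" for g'
      proof -
        have "g' q = Some a"
          using that(1) Some b by (force simp: map_le_def dom_def)
        with x(2)[OF that] query.hyps show ?thesis by (simp add: run_query)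
      qed
      with x(1) show ?thesis by blast
    qed
  qed
  with that show thesis by blast
qed

text \<open>Divergence is secured by finitely much information: either no extension of
  \<open>g\<close> converges, or it suffices to keep one query \<open>x\<close> undefined, and the
  bound \<open>Suc x\<close> covers it.\<close>

lemma seq_comp_stuck_bounded:
  assumes "seq_comp F g n = None"
  obtains M where "\<And>g'. g \<subseteq>\<^sub>m g' \<Longrightarrow> \<forall>x<M. g' x = g x \<Longrightarrow> seq_comp F g' n = None"
proof (cases "\<exists>g\<^sub>1 v. g \<subseteq>\<^sub>m g\<^sub>1 \<and> run F g\<^sub>1 [n] = Some v")
  case True
  then obtain x where "g x = None"
      "\<And>g'. g \<subseteq>\<^sub>m g' \<Longrightarrow> g' x = None \<Longrightarrow> run F g' [n] = None"
    using run_stuck assms unfolding seq_comp_def by metis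
  then show thesis
    by (intro that[of "Suc x"]) (simp add: seq_comp_def)
next
  case False
  then show thesis
    by (intro that[of 0]) (auto simp: seq_comp_def)
qed

section \<open>Meets and joins under extension of their arguments\<close>

lemma subT_meet_eq_Some:
  "(g \<sqinter>\<^sub>s\<^sub>u\<^sub>b\<^sub>T h) (prod_encode (d, prod_encode (e, n))) = Some v \<longleftrightarrow>
     seq_comp (Phi d) g n = Some v \<and> seq_comp (Phi e) h n = Some v"
  by (auto simp: subT_meet_def split: option.splits)

lemma prod_encode_triple_cases:
  obtains d e n where "m = prod_encode (d, prod_encode (e, n))"
  by (metis prod_decode_inverse surj_pair)

lemma subT_meet_mono:
  assumes "g \<subseteq>\<^sub>m g'" "h \<subseteq>\<^sub>m h'"
  shows "g \<sqinter>\<^sub>s\<^sub>u\<^sub>b\<^sub>T h \<subseteq>\<^sub>m g' \<sqinter>\<^sub>s\<^sub>u\<^sub>b\<^sub>T h'"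
proof -
  have "(g' \<sqinter>\<^sub>s\<^sub>u\<^sub>b\<^sub>T h') m = Some v" if "(g \<sqinter>\<^sub>s\<^sub>u\<^sub>b\<^sub>T h) m = Some v" for m v
    using that assms
    by (cases m rule: prod_encode_triple_cases) (auto simp: subT_meet_eq_Some intro: seq_comp_mono)
  then show ?thesis by (auto simp: map_le_def dom_def)
qed

lemma subT_join_mono:
  "f \<subseteq>\<^sub>m f' \<Longrightarrow> g \<subseteq>\<^sub>m g' \<Longrightarrow> f \<oplus>\<^sub>s\<^sub>u\<^sub>b\<^sub>T g \<subseteq>\<^sub>m f' \<oplus>\<^sub>s\<^sub>u\<^sub>b\<^sub>T g'"
  by (auto simp: map_le_def subT_join_def dom_def)

text \<open>Either one of the two computations diverges, which a bound preserves, or they converge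
  to different values, which every extension preserves by monotonicity.\<close>

lemma subT_meet_stuck_bounded:
  assumes "(g \<sqinter>\<^sub>s\<^sub>u\<^sub>b\<^sub>T h) m = None"
  obtains M where "\<And>g' h'. g \<subseteq>\<^sub>m g' \<Longrightarrow> h \<subseteq>\<^sub>m h' \<Longrightarrow> \<forall>x<M. g' x = g x \<and> h' x = h x \<Longrightarrow>
    (g' \<sqinter>\<^sub>s\<^sub>u\<^sub>b\<^sub>T h') m = None"
proof -
  obtain d e n where m: "m = prod_encode (d, prod_encode (e, n))"
    by (rule prod_encode_triple_cases)
  consider "seq_comp (Phi d) g n = None" | "seq_comp (Phi e) h n = None"
    | u v where "seq_comp (Phi d) g n = Some u" "seq_comp (Phi e) h n = Some v" "u \<noteq> v"
    using assms unfolding m by (metis subT_meet_eq_Some option.exhaust option.distinct(1))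
  then show thesis
  proof cases
    case 1
    then obtain M where M: "\<And>g'. g \<subseteq>\<^sub>m g' \<Longrightarrow> \<forall>x<M. g' x = g x \<Longrightarrow> seq_comp (Phi d) g' n = None"
      by (rule seq_comp_stuck_bounded) blast
    show thesis
      by (rule that[of M]) (metis M m not_None_eq subT_meet_eq_Some)
  next
    case 2
    then obtain M where M: "\<And>h'. h \<subseteq>\<^sub>m h' \<Longrightarrow> \<forall>x<M. h' x = h x \<Longrightarrow> seq_comp (Phi e) h' n = None"
      by (rule seq_comp_stuck_bounded) blast
    show thesis
      by (rule that[of M]) (metis M m not_None_eq subT_meet_eq_Some)
  next
    case 3
    show thesis
      by (rule that[of 0]) (metis 3 m not_None_eq option.inject seq_comp_mono subT_meet_eq_Some)
  qed
qed

section \<open>The diagonalization step\<close>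

lemma map_le_if_agree_below:
  fixes f :: "nat \<rightharpoonup> 'a"
  assumes "dom f \<subseteq> {..<N}" "\<forall>x<N. F x = f x"
  shows "f \<subseteq>\<^sub>m F"
  using assms by (auto simp: map_le_def)

text \<open>The part of the meet already decided while \<open>g N\<close> and \<open>h N\<close> are
  open. Only addresses from \<open>N\<close> on compete, since these are fresh for an
  \<open>f\<close> with domain below \<open>N\<close>.\<close>

definition forced_meet :: "nat \<Rightarrow> (nat \<rightharpoonup> nat) \<Rightarrow> (nat \<rightharpoonup> nat) \<Rightarrow> nat \<rightharpoonup> nat" where
  "forced_meet N g h m =
     (if \<forall>a\<ge>N. \<forall>b\<ge>N. (g(N \<mapsto> a) \<sqinter>\<^sub>s\<^sub>u\<^sub>b\<^sub>T h(N \<mapsto> b)) m = (g(N \<mapsto> N) \<sqinter>\<^sub>s\<^sub>u\<^sub>b\<^sub>T h(N \<mapsto> N)) m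
      then (g(N \<mapsto> N) \<sqinter>\<^sub>s\<^sub>u\<^sub>b\<^sub>T h(N \<mapsto> N)) m else None)"

lemma forced_meet_le:
  assumes "N \<le> a" "N \<le> b"
  shows "forced_meet N g h \<subseteq>\<^sub>m g(N \<mapsto> a) \<sqinter>\<^sub>s\<^sub>u\<^sub>b\<^sub>T h(N \<mapsto> b)"
  unfolding map_le_def
proof
  fix m
  assume "m \<in> dom (forced_meet N g h)"
  then have "forced_meet N g h m \<noteq> None" by blast
  with assms show "forced_meet N g h m = (g(N \<mapsto> a) \<sqinter>\<^sub>s\<^sub>u\<^sub>b\<^sub>T h(N \<mapsto> b)) m"
    unfolding forced_meet_def by presburger
qed

text \<open>If every choice gave an answer, the choices \<open>(a, b)\<close> and
  \<open>(a, N)\<close> would agree through the side of \<open>g\<close>, and \<open>(a, N)\<close>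
  and \<open>(N, N)\<close> through the side of \<open>h\<close>, so the answer would be
  forced.\<close>

lemma forced_meet_eq_None:
  assumes "forced_meet N g h m = None"
  obtains a b where "N \<le> a" "N \<le> b" "(g(N \<mapsto> a) \<sqinter>\<^sub>s\<^sub>u\<^sub>b\<^sub>T h(N \<mapsto> b)) m = None"
proof -
  have "\<exists>a\<ge>N. \<exists>b\<ge>N. (g(N \<mapsto> a) \<sqinter>\<^sub>s\<^sub>u\<^sub>b\<^sub>T h(N \<mapsto> b)) m = None"
  proof (rule ccontr)
    assume "\<not> ?thesis"
    then have def: "\<exists>v. (g(N \<mapsto> a) \<sqinter>\<^sub>s\<^sub>u\<^sub>b\<^sub>T h(N \<mapsto> b)) m = Some v" if "N \<le> a" "N \<le> b" for a b
      using that by (metis option.exhaust)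
    obtain d e n where m: "m = prod_encode (d, prod_encode (e, n))"
      by (rule prod_encode_triple_cases)
    have "(g(N \<mapsto> a) \<sqinter>\<^sub>s\<^sub>u\<^sub>b\<^sub>T h(N \<mapsto> b)) m = (g(N \<mapsto> N) \<sqinter>\<^sub>s\<^sub>u\<^sub>b\<^sub>T h(N \<mapsto> N)) m"
      if "N \<le> a" "N \<le> b" for a b
      using def[OF that] def[OF that(1) order_refl] def[OF order_refl order_refl]
      unfolding m by (metis option.inject subT_meet_eq_Some)
    then have "forced_meet N g h m = (g(N \<mapsto> N) \<sqinter>\<^sub>s\<^sub>u\<^sub>b\<^sub>T h(N \<mapsto> N)) m"
      unfolding forced_meet_def by (intro if_P allI impI)
    with assms def[of N N] show False by simp
  qed
  with that show thesis by blast
qed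

text \<open>The inequality is claimed for all \<open>F\<close>, \<open>G\<close>, \<open>H\<close>
  that agree with the new maps below \<open>N'\<close>, so that later stages cannot spoil
  it.\<close>

lemma diagonalization_step:
  fixes f g h :: "nat \<rightharpoonup> nat"
  assumes dom: "dom f \<subseteq> {..<N}" "dom g \<subseteq> {..<N}" "dom h \<subseteq> {..<N}"
  obtains a b c N' where "N < N'" "N \<le> a" "a < N'" "N \<le> b" "b < N'"
    "\<And>F G H. \<forall>x<N'. F x = (f(a \<mapsto> c, b \<mapsto> c)) x \<Longrightarrow> \<forall>x<N'. G x = (g(N \<mapsto> a)) x \<Longrightarrow>
      \<forall>x<N'. H x = (h(N \<mapsto> b)) x \<Longrightarrow> seq_comp \<Psi> (F \<oplus>\<^sub>s\<^sub>u\<^sub>b\<^sub>T (G \<sqinter>\<^sub>s\<^sub>u\<^sub>b\<^sub>T H)) m \<noteq> Some c"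
proof -
  define V where "V = f \<oplus>\<^sub>s\<^sub>u\<^sub>b\<^sub>T forced_meet N g h"
  \<comment> \<open>\<open>V\<close> lies below every oracle that can still arise: \<open>a\<close>
    and \<open>b\<close> are at least \<open>N\<close>, so \<open>f\<close> is not overwritten and
    the forced answers remain valid.\<close>
  have le: "f \<subseteq>\<^sub>m F" "g(N \<mapsto> a) \<subseteq>\<^sub>m G" "h(N \<mapsto> b) \<subseteq>\<^sub>m H" "V \<subseteq>\<^sub>m F \<oplus>\<^sub>s\<^sub>u\<^sub>b\<^sub>T (G \<sqinter>\<^sub>s\<^sub>u\<^sub>b\<^sub>T H)"
    if ineq: "N < N'" "N \<le> a" "N \<le> b"
      and F: "\<forall>x<N'. F x = (f(a \<mapsto> c, b \<mapsto> c)) x"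
      and G: "\<forall>x<N'. G x = (g(N \<mapsto> a)) x"
      and H: "\<forall>x<N'. H x = (h(N \<mapsto> b)) x" for a b c N' F G H
  proof -
    show *: "f \<subseteq>\<^sub>m F"
      using F ineq dom(1) by (intro map_le_if_agree_below[of f N]) auto
    show **: "g(N \<mapsto> a) \<subseteq>\<^sub>m G"
      using subset_trans[OF dom(2), of "{..<N'}"] ineq(1)
      by (intro map_le_if_agree_below[OF _ G]) (simp del: fun_upd_apply)
    show ***: "h(N \<mapsto> b) \<subseteq>\<^sub>m H"
      using subset_trans[OF dom(3), of "{..<N'}"] ineq(1)
      by (intro map_le_if_agree_below[OF _ H]) (simp del: fun_upd_apply)
    show "V \<subseteq>\<^sub>m F \<oplus>\<^sub>s\<^sub>u\<^sub>b\<^sub>T (G \<sqinter>\<^sub>s\<^sub>u\<^sub>b\<^sub>T H)"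
      unfolding V_def
      by (rule subT_join_mono[OF * map_le_trans[OF forced_meet_le subT_meet_mono[OF ** ***]]])
        (use ineq in auto)
  qed
  show thesis
  proof (cases "seq_comp \<Psi> V m")
    case (Some v)
    show thesis
    \<comment> \<open>The output \<open>v\<close> is fixed before \<open>f\<close> is defined at
      \<open>N\<close>, so \<open>Suc v\<close> can be put there.\<close>
    proof (rule that[of "Suc N" N N "Suc v"])
      fix F G H
      assume "\<forall>x<Suc N. F x = (f(N \<mapsto> Suc v, N \<mapsto> Suc v)) x"
        "\<forall>x<Suc N. G x = (g(N \<mapsto> N)) x" "\<forall>x<Suc N. H x = (h(N \<mapsto> N)) x"
      from seq_comp_mono[OF Some le(4)[OF _ _ _ this]]
      show "seq_comp \<Psi> (F \<oplus>\<^sub>s\<^sub>u\<^sub>b\<^sub>T (G \<sqinter>\<^sub>s\<^sub>u\<^sub>b\<^sub>T H)) m \<noteq> Some (Suc v)" by simp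
    qed auto
  next
    case None
    show thesis
    \<comment> \<open>If no extension of \<open>V\<close> makes the run converge, any choice works.
      Otherwise the run waits for one query \<open>x\<close>, whose parity tells whether
      \<open>f\<close> or the meet has to stay undefined.\<close>
    proof (cases "\<exists>V' v. V \<subseteq>\<^sub>m V' \<and> run \<Psi> V' [m] = Some v")
      case False
      show thesis
      proof (rule that[of "Suc N" N N 0])
        fix F G H
        assume "\<forall>x<Suc N. F x = (f(N \<mapsto> 0, N \<mapsto> 0)) x"
          "\<forall>x<Suc N. G x = (g(N \<mapsto> N)) x" "\<forall>x<Suc N. H x = (h(N \<mapsto> N)) x"
        from le(4)[OF _ _ _ this] False
        show "seq_comp \<Psi> (F \<oplus>\<^sub>s\<^sub>u\<^sub>b\<^sub>T (G \<sqinter>\<^sub>s\<^sub>u\<^sub>b\<^sub>T H)) m \<noteq> Some 0"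
          by (auto simp: seq_comp_def)
      qed auto
    next
      case True
      then obtain x where x: "V x = None"
          "\<And>V'. V \<subseteq>\<^sub>m V' \<Longrightarrow> V' x = None \<Longrightarrow> seq_comp \<Psi> V' m = None"
        using run_stuck None unfolding seq_comp_def by metis
      show thesis
      proof (cases "even x")
        case even: True
        define y where "y = x div 2"
        have y: "f y = None" using x(1) even by (simp add: V_def subT_join_def y_def)
        \<comment> \<open>Being greater than \<open>y\<close>, the address \<open>a\<close> leaves
          \<open>f y\<close> undefined and brings \<open>y\<close> under the new bound.\<close>
        define a where "a = Suc (max N y)"
        show thesis
        proof (rule that[of "Suc a" a a 0])
          fix F G H
          assume FGH: "\<forall>x<Suc a. F x = (f(a \<mapsto> 0, a \<mapsto> 0)) x"
            "\<forall>x<Suc a. G x = (g(N \<mapsto> a)) x" "\<forall>x<Suc a. H x = (h(N \<mapsto> a)) x"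
          have "F y = None" using FGH(1) y by (simp add: a_def)
          then have "(F \<oplus>\<^sub>s\<^sub>u\<^sub>b\<^sub>T (G \<sqinter>\<^sub>s\<^sub>u\<^sub>b\<^sub>T H)) x = None"
            using even by (simp add: subT_join_def y_def)
          with x(2)[OF le(4)[OF _ _ _ FGH]]
          show "seq_comp \<Psi> (F \<oplus>\<^sub>s\<^sub>u\<^sub>b\<^sub>T (G \<sqinter>\<^sub>s\<^sub>u\<^sub>b\<^sub>T H)) m \<noteq> Some 0"
            by (simp add: a_def)
        qed (auto simp: a_def)
      next
        case odd: False
        then have "forced_meet N g h (x div 2) = None"
          using x(1) by (simp add: V_def subT_join_def)
        then obtain a b where ab: "N \<le> a" "N \<le> b"
          and ab_None: "(g(N \<mapsto> a) \<sqinter>\<^sub>s\<^sub>u\<^sub>b\<^sub>T h(N \<mapsto> b)) (x div 2) = None"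
          by (rule forced_meet_eq_None)
        obtain M where
          M: "\<And>G H. g(N \<mapsto> a) \<subseteq>\<^sub>m G \<Longrightarrow> h(N \<mapsto> b) \<subseteq>\<^sub>m H \<Longrightarrow>
            \<forall>x<M. G x = (g(N \<mapsto> a)) x \<and> H x = (h(N \<mapsto> b)) x \<Longrightarrow>
            (G \<sqinter>\<^sub>s\<^sub>u\<^sub>b\<^sub>T H) (x div 2) = None"
          by (rule subT_meet_stuck_bounded[OF ab_None]) blast
        \<comment> \<open>Passing \<open>M\<close> keeps the meet undefined at
          \<open>x div 2\<close> for good; passing \<open>a\<close> and \<open>b\<close> settles the
          new values of \<open>f\<close>.\<close>
        define N' where "N' = Suc (max M (max a b))"
        have N': "N < N'" "a < N'" "b < N'" "M < N'"
          using ab by (auto simp: N'_def)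
        show thesis
        proof (rule that[of N' a b 0])
          fix F G H
          assume FGH: "\<forall>x<N'. F x = (f(a \<mapsto> 0, b \<mapsto> 0)) x"
            "\<forall>x<N'. G x = (g(N \<mapsto> a)) x" "\<forall>x<N'. H x = (h(N \<mapsto> b)) x"
          note le' = le[OF N'(1) ab FGH]
          have "(G \<sqinter>\<^sub>s\<^sub>u\<^sub>b\<^sub>T H) (x div 2) = None"
            using M[OF le'(2,3)] FGH N' by simp
          then have "(F \<oplus>\<^sub>s\<^sub>u\<^sub>b\<^sub>T (G \<sqinter>\<^sub>s\<^sub>u\<^sub>b\<^sub>T H)) x = None"
            using odd by (simp add: subT_join_def)
          with x(2)[OF le'(4)]
          show "seq_comp \<Psi> (F \<oplus>\<^sub>s\<^sub>u\<^sub>b\<^sub>T (G \<sqinter>\<^sub>s\<^sub>u\<^sub>b\<^sub>T H)) m \<noteq> Some 0" by simp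
        qed (use ab N' in auto)
      qed
    qed
  qed
qed

section \<open>The construction\<close>

lemma limit_of_settled_maps:
  fixes f :: "nat \<Rightarrow> nat \<rightharpoonup> 'a" and N :: "nat \<Rightarrow> nat"
  assumes N: "\<And>s. N s < N (Suc s)" and f: "\<And>s x. x < N s \<Longrightarrow> f (Suc s) x = f s x"
  obtains F where "\<And>s x. x < N s \<Longrightarrow> F x = f s x"
proof
  have mono: "N s \<le> N t" if "s \<le> t" for s t
    using that by (rule lift_Suc_mono_le[of N, OF less_imp_le[OF N]])
  have stable: "f t x = f s x" if "s \<le> t" "x < N s" for s t x
    using that(1)
  proof (induction rule: dec_induct)
    case (step t)
    then show ?case using f[of x t] mono[of s t] that(2) by simp
  qed simp
  have "strict_mono N" using N by (rule strict_mono_Suc_iff[THEN iffD2, rule_format])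
  then have "x < N (Suc x)" for x
    using strict_mono_imp_increasing[of N "Suc x"] by simp
  \<comment> \<open>The limit takes at \<open>x\<close> the value of stage \<open>Suc x\<close>, by
    which time the bound has passed \<open>x\<close>.\<close>
  then show "f (Suc x) x = f s x" if "x < N s" for s x
    using stable[of "Suc x" s x] stable[of s "Suc x" x] that by (cases "s \<le> Suc x") auto
qed

text \<open>Stage \<open>e\<close> defeats \<open>\<Psi> e\<close>. The input map
  \<open>\<tau>\<close> will send \<open>n\<close> to a code at which the meet of the two joins has
  the value \<open>c\<close>.\<close>

lemma diagonal_functions:
  fixes \<Psi> :: "nat \<Rightarrow> nat list \<rightharpoonup> bool \<times> nat" and \<tau> :: "nat \<Rightarrow> nat"
  obtains f g h :: "nat \<rightharpoonup> nat" where
    "\<And>e. \<exists>n a b c. g n = Some a \<and> h n = Some b \<and> f a = Some c \<and> f b = Some c \<and>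
      seq_comp (\<Psi> e) (f \<oplus>\<^sub>s\<^sub>u\<^sub>b\<^sub>T (g \<sqinter>\<^sub>s\<^sub>u\<^sub>b\<^sub>T h)) (\<tau> n) \<noteq> Some c"
proof -
  define good :: "nat \<Rightarrow> (nat \<rightharpoonup> nat) \<times> (nat \<rightharpoonup> nat) \<times> (nat \<rightharpoonup> nat) \<times> nat \<Rightarrow> bool" where
    "good = (\<lambda>e (f, g, h, N). dom f \<subseteq> {..<N} \<and> dom g \<subseteq> {..<N} \<and> dom h \<subseteq> {..<N})"
  \<comment> \<open>Below \<open>N\<close> the maps must agree, not merely extend one another:
    undefined places are settled too. With \<open>n\<close>, \<open>a\<close>, \<open>b\<close>
    below \<open>N'\<close> the new values survive in the limit.\<close>
  define next_of where
    "next_of = (\<lambda>e (f, g, h, N) (f', g', h', N').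
       N < N' \<and> (\<forall>x<N. f' x = f x) \<and> (\<forall>x<N. g' x = g x) \<and> (\<forall>x<N. h' x = h x) \<and>
       (\<exists>n a b c. n < N' \<and> a < N' \<and> b < N' \<and>
          g' n = Some a \<and> h' n = Some b \<and> f' a = Some c \<and> f' b = Some c \<and>
          (\<forall>F G H. (\<forall>x<N'. F x = f' x) \<longrightarrow> (\<forall>x<N'. G x = g' x) \<longrightarrow> (\<forall>x<N'. H x = h' x) \<longrightarrow>
             seq_comp (\<Psi> e) (F \<oplus>\<^sub>s\<^sub>u\<^sub>b\<^sub>T (G \<sqinter>\<^sub>s\<^sub>u\<^sub>b\<^sub>T H)) (\<tau> n) \<noteq> Some c)))"
  have "\<exists>\<sigma>. \<forall>e. good e (\<sigma> e) \<and> next_of e (\<sigma> e) (\<sigma> (Suc e))"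
  proof (rule dependent_nat_choice)
    show "\<exists>p. good 0 p"
      by (rule exI[of _ "(Map.empty, Map.empty, Map.empty, 0)"]) (simp add: good_def)
  next
    fix p e
    assume "good e p"
    obtain f g h N where p: "p = (f, g, h, N)" by (cases p)
    then have dom: "dom f \<subseteq> {..<N}" "dom g \<subseteq> {..<N}" "dom h \<subseteq> {..<N}"
      using \<open>good e p\<close> by (auto simp: good_def)
    obtain a b c N' where *: "N < N'" "N \<le> a" "a < N'" "N \<le> b" "b < N'"
      "\<And>F G H. \<forall>x<N'. F x = (f(a \<mapsto> c, b \<mapsto> c)) x \<Longrightarrow> \<forall>x<N'. G x = (g(N \<mapsto> a)) x \<Longrightarrow>
        \<forall>x<N'. H x = (h(N \<mapsto> b)) x \<Longrightarrow>
        seq_comp (\<Psi> e) (F \<oplus>\<^sub>s\<^sub>u\<^sub>b\<^sub>T (G \<sqinter>\<^sub>s\<^sub>u\<^sub>b\<^sub>T H)) (\<tau> N) \<noteq> Some c"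
      by (rule diagonalization_step[OF dom, of "\<Psi> e" "\<tau> N"]) (rule that)
    let ?q = "(f(a \<mapsto> c, b \<mapsto> c), g(N \<mapsto> a), h(N \<mapsto> b), N')"
    have "good (Suc e) ?q"
      using dom * by (auto simp: good_def)
    moreover have "next_of e p ?q"
      unfolding next_of_def p prod.case
    proof (rule conjI[OF *(1)], intro conjI)
      show "\<exists>n a' b' c'. n < N' \<and> a' < N' \<and> b' < N' \<and>
          (g(N \<mapsto> a)) n = Some a' \<and> (h(N \<mapsto> b)) n = Some b' \<and>
          (f(a \<mapsto> c, b \<mapsto> c)) a' = Some c' \<and> (f(a \<mapsto> c, b \<mapsto> c)) b' = Some c' \<and>
          (\<forall>F G H. (\<forall>x<N'. F x = (f(a \<mapsto> c, b \<mapsto> c)) x) \<longrightarrow> (\<forall>x<N'. G x = (g(N \<mapsto> a)) x) \<longrightarrow>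
             (\<forall>x<N'. H x = (h(N \<mapsto> b)) x) \<longrightarrow>
             seq_comp (\<Psi> e) (F \<oplus>\<^sub>s\<^sub>u\<^sub>b\<^sub>T (G \<sqinter>\<^sub>s\<^sub>u\<^sub>b\<^sub>T H)) (\<tau> n) \<noteq> Some c')"
      proof (rule exI[of _ N], rule exI[of _ a], rule exI[of _ b], rule exI[of _ c], intro conjI)
        show "\<forall>F G H. (\<forall>x<N'. F x = (f(a \<mapsto> c, b \<mapsto> c)) x) \<longrightarrow> (\<forall>x<N'. G x = (g(N \<mapsto> a)) x) \<longrightarrow>
             (\<forall>x<N'. H x = (h(N \<mapsto> b)) x) \<longrightarrow>
             seq_comp (\<Psi> e) (F \<oplus>\<^sub>s\<^sub>u\<^sub>b\<^sub>T (G \<sqinter>\<^sub>s\<^sub>u\<^sub>b\<^sub>T H)) (\<tau> N) \<noteq> Some c"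
          by (intro allI impI) (rule *(6))
      qed (use *(1-5) in simp_all)
    qed (use *(1-5) in auto)
    ultimately show "\<exists>q. good (Suc e) q \<and> next_of e p q" by blast
  qed
  then obtain \<sigma> where \<sigma>: "\<And>e. next_of e (\<sigma> e) (\<sigma> (Suc e))" by blast
  define f g h N where "f e = fst (\<sigma> e)" and "g e = fst (snd (\<sigma> e))"
    and "h e = fst (snd (snd (\<sigma> e)))" and "N e = snd (snd (snd (\<sigma> e)))" for e
  have "\<sigma> e = (f e, g e, h e, N e)" for e
    by (simp add: f_def g_def h_def N_def)
  note step = \<sigma>[unfolded this next_of_def prod.case]
  have N: "N e < N (Suc e)" for e using step[of e] by blast
  obtain F where F: "\<And>s x. x < N s \<Longrightarrow> F x = f s x"
    by (rule limit_of_settled_maps[of N f, OF N]) (use step in blast)+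
  obtain G where G: "\<And>s x. x < N s \<Longrightarrow> G x = g s x"
    by (rule limit_of_settled_maps[of N g, OF N]) (use step in blast)+
  obtain H where H: "\<And>s x. x < N s \<Longrightarrow> H x = h s x"
    by (rule limit_of_settled_maps[of N h, OF N]) (use step in blast)+
  show thesis
  proof (rule that[of G H F])
    fix e
    \<comment> \<open>The limits agree with stage \<open>Suc e\<close> below
      \<open>N (Suc e)\<close>, so they are among the triples for which that stage secured the
      inequality.\<close>
    from step[of e] obtain n a b c where
      "n < N (Suc e)" "a < N (Suc e)" "b < N (Suc e)"
      "g (Suc e) n = Some a" "h (Suc e) n = Some b" "f (Suc e) a = Some c" "f (Suc e) b = Some c"
      "seq_comp (\<Psi> e) (F \<oplus>\<^sub>s\<^sub>u\<^sub>b\<^sub>T (G \<sqinter>\<^sub>s\<^sub>u\<^sub>b\<^sub>T H)) (\<tau> n) \<noteq> Some c"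
      using F[of _ "Suc e"] G[of _ "Suc e"] H[of _ "Suc e"] by blast
    then show "\<exists>n a b c. G n = Some a \<and> H n = Some b \<and> F a = Some c \<and> F b = Some c \<and>
        seq_comp (\<Psi> e) (F \<oplus>\<^sub>s\<^sub>u\<^sub>b\<^sub>T (G \<sqinter>\<^sub>s\<^sub>u\<^sub>b\<^sub>T H)) (\<tau> n) \<noteq> Some c"
      by (metis F G H)
  qed
qed

section \<open>An index for composing the two halves of a join\<close>

text \<open>A recursion whose step ignores the previous value \<open>i\<close> is a case distinction
  between zero and successor.\<close>

lemma eval_Prec_cases:
  assumes "eval p a = Some u" "\<And>y i. eval q (prod_encode (a, prod_encode (y, i))) = Some (w y)"
  shows "eval (Prec p q) (prod_encode (a, n)) = Some (case n of 0 \<Rightarrow> u | Suc y \<Rightarrow> w y)"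
proof -
  have "rec_nat (eval p a)
      (\<lambda>y r. Option.bind r (\<lambda>i. eval q (prod_encode (a, prod_encode (y, i))))) n =
    Some (case n of 0 \<Rightarrow> u | Suc y \<Rightarrow> w y)"
    by (induction n) (simp_all add: assms)
  then show ?thesis by simp
qed

definition id_code :: code where
  "id_code = Pairing ProjL ProjR"

text \<open>\<open>Pairing Zero id_code\<close> supplies a dummy parameter, and
  \<open>Comp ProjL ProjR\<close> reads the recursion counter. The predecessor serves to strip the
  \<open>Suc\<close> from the code of a nonempty list.\<close>

definition pred_code :: code where
  "pred_code = Comp (Prec Zero (Comp ProjL ProjR)) (Pairing Zero id_code)"

definition double_code :: code where
  "double_code = Comp (Prec Zero (Comp Succ (Comp Succ (Comp ProjR ProjR)))) (Pairing Zero id_code)"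

lemma eval_id_code [simp]: "eval id_code x = Some x"
  by (simp add: id_code_def)

lemma eval_pred_code [simp]: "eval pred_code x = Some (x - 1)"
  by (simp add: pred_code_def eval_Prec_cases[where u = 0 and w = "\<lambda>y. y"]
      del: eval.simps(7) split: nat.split)

lemma eval_double_code [simp]: "eval double_code x = Some (2 * x)"
proof -
  have "rec_nat (Some 0) (\<lambda>y r. Option.bind r (\<lambda>i. Some (Suc (Suc i)))) x = Some (2 * x)"
    by (induction x) simp_all
  then show ?thesis by (simp add: double_code_def)
qed

text \<open>
  On the coded histories \<open>[n]\<close>, \<open>[n, a]\<close>, \<open>[n, a, c]\<close> the code asks the second half of the join for
  \<open>n\<close>, asks the first half for \<open>a\<close>, and halts with output \<open>c\<close>, respectively.
\<close>

definition after_answer_code :: code where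
  "after_answer_code = Prec (Pairing Zero double_code)
     (Pairing (Comp Succ Zero) (Comp ProjL (Comp ProjL ProjR)))"

definition join_comp_code :: code where
  "join_comp_code = Comp
     (Prec (Pairing Zero (Comp Succ (Comp double_code ProjL)))
        (Comp after_answer_code (Comp ProjL ProjR)))
     (Comp (Pairing id_code ProjR) pred_code)"

lemma eval_after_answer_code:
  "eval after_answer_code (prod_encode (a, r)) = Some (case r of
     0 \<Rightarrow> prod_encode (0, 2 * a) | Suc z \<Rightarrow> prod_encode (1, fst (prod_decode z)))"
  unfolding after_answer_code_def by (rule eval_Prec_cases) simp_all

text \<open>The empty list has code 0 and a nonempty one the successor of a pair of head and coded
  tail, so each \<open>case\<close> asks whether the history ends here. The tail \<open>r\<close> is
  duplicated, once to drive the recursion and once inside the parameter that holds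
  \<open>n\<close>.\<close>

lemma eval_join_comp_code:
  "eval join_comp_code (Suc (prod_encode (n, r))) = Some (case r of
     0 \<Rightarrow> prod_encode (0, Suc (2 * n))
   | Suc y \<Rightarrow> (case snd (prod_decode y) of
       0 \<Rightarrow> prod_encode (0, 2 * fst (prod_decode y))
     | Suc z \<Rightarrow> prod_encode (1, fst (prod_decode z))))"
proof -
  have *: "eval after_answer_code y = Some (case snd (prod_decode y) of
      0 \<Rightarrow> prod_encode (0, 2 * fst (prod_decode y))
    | Suc z \<Rightarrow> prod_encode (1, fst (prod_decode z)))" for y
    using eval_after_answer_code[of "fst (prod_decode y)" "snd (prod_decode y)"] by simp
  have "eval (Prec (Pairing Zero (Comp Succ (Comp double_code ProjL)))
      (Comp after_answer_code (Comp ProjL ProjR))) (prod_encode (prod_encode (n, r), r)) =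
    Some (case r of 0 \<Rightarrow> prod_encode (0, Suc (2 * n))
     | Suc y \<Rightarrow> (case snd (prod_decode y) of
         0 \<Rightarrow> prod_encode (0, 2 * fst (prod_decode y))
       | Suc z \<Rightarrow> prod_encode (1, fst (prod_decode z))))"
    by (rule eval_Prec_cases) (simp_all add: *)
  then show ?thesis by (simp add: join_comp_code_def del: eval.simps(7))
qed

lemma seq_comp_join_comp_code:
  assumes "g n = Some a" "f a = Some c"
  shows "seq_comp (Phi (index_of join_comp_code)) (f \<oplus>\<^sub>s\<^sub>u\<^sub>b\<^sub>T g) n = Some c"
proof -
  let ?F = "Phi (index_of join_comp_code)" and ?O = "f \<oplus>\<^sub>s\<^sub>u\<^sub>b\<^sub>T g"
  have F: "?F [n] = Some (False, Suc (2 * n))" "?F [n, a] = Some (False, 2 * a)"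
      "?F [n, a, c] = Some (True, c)"
    by (simp_all add: Phi_def eval_join_comp_code)
  have "?O (Suc (2 * n)) = Some a" "?O (2 * a) = Some c"
    using assms by (simp_all add: subT_join_def)
  then have "run ?F ?O [n] = run ?F ?O [n, a, c]"
    using run_query[of ?F "[n]" _ ?O] run_query[of ?F "[n, a]" _ ?O] F(1,2) by simp
  also have "\<dots> = Some c" using F(3) by (rule run_halt)
  finally show ?thesis by (simp add: seq_comp_def)
qed

section \<open>Failure of the distributive law\<close>

theorem theorem4p9:
  "\<exists>f g h :: nat \<rightharpoonup> nat.
     \<not> (f \<oplus>\<^sub>s\<^sub>u\<^sub>b\<^sub>T (g \<sqinter>\<^sub>s\<^sub>u\<^sub>b\<^sub>T h) \<equiv>\<^sub>s\<^sub>u\<^sub>b\<^sub>T (f \<oplus>\<^sub>s\<^sub>u\<^sub>b\<^sub>T g) \<sqinter>\<^sub>s\<^sub>u\<^sub>b\<^sub>T (f \<oplus>\<^sub>s\<^sub>u\<^sub>b\<^sub>T h))"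
proof -
  define d where "d = index_of join_comp_code"
  \<comment> \<open>The same index \<open>d\<close> serves both factors of the meet, because the
    code does not depend on the oracle.\<close>
  define \<tau> where "\<tau> n = prod_encode (d, prod_encode (d, n))" for n
  obtain f g h where diag:
    "\<And>e. \<exists>n a b c. g n = Some a \<and> h n = Some b \<and> f a = Some c \<and> f b = Some c \<and>
      seq_comp (Phi e) (f \<oplus>\<^sub>s\<^sub>u\<^sub>b\<^sub>T (g \<sqinter>\<^sub>s\<^sub>u\<^sub>b\<^sub>T h)) (\<tau> n) \<noteq> Some c"
    by (rule diagonal_functions[of Phi \<tau>]) (rule that)
  \<comment> \<open>This is the direction to refute; the opposite reduction holds in every
    lattice.\<close>
  have "\<not> (f \<oplus>\<^sub>s\<^sub>u\<^sub>b\<^sub>T g) \<sqinter>\<^sub>s\<^sub>u\<^sub>b\<^sub>T (f \<oplus>\<^sub>s\<^sub>u\<^sub>b\<^sub>T h) \<le>\<^sub>s\<^sub>u\<^sub>b\<^sub>T f \<oplus>\<^sub>s\<^sub>u\<^sub>b\<^sub>T (g \<sqinter>\<^sub>s\<^sub>u\<^sub>b\<^sub>T h)"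
  proof
    assume "(f \<oplus>\<^sub>s\<^sub>u\<^sub>b\<^sub>T g) \<sqinter>\<^sub>s\<^sub>u\<^sub>b\<^sub>T (f \<oplus>\<^sub>s\<^sub>u\<^sub>b\<^sub>T h) \<le>\<^sub>s\<^sub>u\<^sub>b\<^sub>T f \<oplus>\<^sub>s\<^sub>u\<^sub>b\<^sub>T (g \<sqinter>\<^sub>s\<^sub>u\<^sub>b\<^sub>T h)"
    then obtain e where
      e: "(f \<oplus>\<^sub>s\<^sub>u\<^sub>b\<^sub>T g) \<sqinter>\<^sub>s\<^sub>u\<^sub>b\<^sub>T (f \<oplus>\<^sub>s\<^sub>u\<^sub>b\<^sub>T h) \<subseteq>\<^sub>m seq_comp (Phi e) (f \<oplus>\<^sub>s\<^sub>u\<^sub>b\<^sub>T (g \<sqinter>\<^sub>s\<^sub>u\<^sub>b\<^sub>T h))"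
      unfolding subT_le_def by blast
    from diag[of e] obtain n a b c where
        n: "g n = Some a" "h n = Some b" "f a = Some c" "f b = Some c"
      and ne: "seq_comp (Phi e) (f \<oplus>\<^sub>s\<^sub>u\<^sub>b\<^sub>T (g \<sqinter>\<^sub>s\<^sub>u\<^sub>b\<^sub>T h)) (\<tau> n) \<noteq> Some c" by blast
    \<comment> \<open>The left factor reaches \<open>c\<close> through \<open>a = g n\<close>, the
      right one through \<open>b = h n\<close>.\<close>
    have "((f \<oplus>\<^sub>s\<^sub>u\<^sub>b\<^sub>T g) \<sqinter>\<^sub>s\<^sub>u\<^sub>b\<^sub>T (f \<oplus>\<^sub>s\<^sub>u\<^sub>b\<^sub>T h)) (\<tau> n) = Some c"
      unfolding \<tau>_def d_def subT_meet_eq_Some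
      using n by (simp add: seq_comp_join_comp_code)
    with e ne show False by (metis domI map_le_def)
  qed
  then have "\<not> (f \<oplus>\<^sub>s\<^sub>u\<^sub>b\<^sub>T (g \<sqinter>\<^sub>s\<^sub>u\<^sub>b\<^sub>T h) \<equiv>\<^sub>s\<^sub>u\<^sub>b\<^sub>T (f \<oplus>\<^sub>s\<^sub>u\<^sub>b\<^sub>T g) \<sqinter>\<^sub>s\<^sub>u\<^sub>b\<^sub>T (f \<oplus>\<^sub>s\<^sub>u\<^sub>b\<^sub>T h))"
    by (simp add: subT_equiv_def)
  then show ?thesis by (intro exI)
qed

end
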